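(* Let $(X,d)$ be a compact metric space and $T:X\to X$ a continuous map such that the dynamical system $(X,d,T)$ has the specification property. Let $z_0\in X$ be a non-transitive point, i.e. $\overline{O_T(z_0)}\neq X$, and let $\varphi\in C(X)$. Then either $E(z_0)=\emptyset$ or $$P(E(z_0),\varphi)=P_{top}(\varphi).$$
   Context: $C(X)$ is the space of real-valued continuous functions on $X$. For $x\in X$, $O_T(x)=\{x,Tx,\dots,T^nx,\dots\}$ is the forward orbit. The non-dense orbit set of $z_0\in X$ is $E(z_0)=\{x\in X: z_0\notin\overline{\{T^n x:n\ge 0\}}\}$. Specification property: for each $\epsilon>0$ there is an integer $m=m(\epsilon)$ such that for any finite collection $\{I_j=[a_j,b_j]\subset\mathbb N: j=1,\dots,k\}$ of finite intervals with $a_{j+1}-b_j\ge m(\epsilon)$ for $j=1,\dots,k-1$ and any $x_1,\dots,x_k\in X$, there exists $x\in X$ with $d(T^{p+a_j}x,T^p x_j)<\epsilon$ for all $p=0,\dots,b_j-a_j$ and every $j=1,\dots,k$. For $n\in\mathbb N$, $d_n(x,y)=\max_{0\le i\le n-1}d(T^ix,T^iy)$, $B_n(x,\epsilon)=\{y\in X: d_n(x,y)<\epsilon\}$, and $S_n\varphi(x)=\sum_{i=0}^{n-1}\varphi(T^ix)$. A set $E\subset X$ is $(n,\epsilon)$-separated if $d_n(x,y)>\epsilon$ for all distinct $x,y\in E$. Classical topological pressure: with $P(\varphi,n,\epsilon)=\sup\{\sum_{x\in E}e^{S_n\varphi(x)}: E \text{ is an } (n,\epsilon)\text{-separated subset of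 } X\}$, $$P_{top}(\varphi)=\lim_{\epsilon\to0}\liminf_{n\to\infty}\tfrac1n\log P(\varphi,n,\epsilon)=\lim_{\epsilon\to0}\limsup_{n\to\infty}\tfrac1n\log P(\varphi,n,\epsilon).$$ Topological pressure of a (not necessarily compact) Borel subset $Z\subset X$: let $\Gamma_n(Z,\epsilon)$ be the collection of all finite or countable covers of $Z$ by sets of the form $B_m(x,\epsilon)$ with $m\ge n$. Set $$M(Z,t,\varphi,n,\epsilon)=\inf_{\mathcal C\in\Gamma_n(Z,\epsilon)}\sum_{B_m(x,\epsilon)\in\mathcal C}\exp\Big(-tm+\sup_{y\in B_m(x,\epsilon)}S_m\varphi(y)\Big),$$ $M(Z,t,\varphi,\epsilon)=\lim_{n\to\infty}M(Z,t,\varphi,n,\epsilon)$, $P(Z,\varphi,\epsilon)=\inf\{t:M(Z,t,\varphi,\epsilon)=0\}=\sup\{t:M(Z,t,\varphi,\epsilon)=\infty\}$, and $P(Z,\varphi)=\lim_{\epsilon\to0}P(Z,\varphi,\epsilon)$. *)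

theory Defs
  imports "HOL-Analysis.Analysis"
begin

(* The phase space X is the whole type 'a; its compactness, compact (UNIV :: 'a set), is an
   explicit hypothesis of the theorem.  T is iterated with (T ^^ n). *)

definition forward_orbit :: "('a \<Rightarrow> 'a) \<Rightarrow> 'a \<Rightarrow> 'a set" where
  "forward_orbit T x = range (\<lambda>n::nat. (T ^^ n) x)"

definition non_dense_orbit_set :: "('a::topological_space \<Rightarrow> 'a) \<Rightarrow> 'a \<Rightarrow> 'a set" where
  "non_dense_orbit_set T z0 = {x. z0 \<notin> closure (forward_orbit T x)}"

(* The gap condition a_{j+1} - b_j >= m is written without truncated subtraction. *)
definition specification_property :: "('a::metric_space \<Rightarrow> 'a) \<Rightarrow> bool" where
  "specification_property T \<longleftrightarrow>
     (\<forall>\<epsilon>>0. \<exists>m::nat. \<forall>(k::nat) (a::nat \<Rightarrow> nat) (b::nat \<Rightarrow> nat) (xs::nat \<Rightarrow> 'a).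
        (\<forall>j\<in>{1..k}. a j \<le> b j) \<and> (\<forall>j\<in>{1..<k}. b j + m \<le> a (Suc j)) \<longrightarrow>
        (\<exists>x. \<forall>j\<in>{1..k}. \<forall>p\<in>{0..b j - a j}.
            dist ((T ^^ (p + a j)) x) ((T ^^ p) (xs j)) < \<epsilon>))"

(* Meaningful for n >= 1.  For n = 0 this is Max {}, which is unspecified, but every quantity
   below only depends on the behaviour as n tends to infinity. *)
definition dyn_dist :: "('a::metric_space \<Rightarrow> 'a) \<Rightarrow> nat \<Rightarrow> 'a \<Rightarrow> 'a \<Rightarrow> real" where
  "dyn_dist T n x y = Max ((\<lambda>i. dist ((T ^^ i) x) ((T ^^ i) y)) ` {..<n})"

definition bowen_ball :: "('a::metric_space \<Rightarrow> 'a) \<Rightarrow> nat \<Rightarrow> 'a \<Rightarrow> real \<Rightarrow> 'a set" where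
  "bowen_ball T n x \<epsilon> = {y. dyn_dist T n x y < \<epsilon>}"

definition birkhoff_sum :: "('a \<Rightarrow> 'a) \<Rightarrow> nat \<Rightarrow> ('a \<Rightarrow> real) \<Rightarrow> 'a \<Rightarrow> real" where
  "birkhoff_sum T n \<phi> x = (\<Sum>i<n. \<phi> ((T ^^ i) x))"

definition dyn_separated :: "('a::metric_space \<Rightarrow> 'a) \<Rightarrow> nat \<Rightarrow> real \<Rightarrow> 'a set \<Rightarrow> bool" where
  "dyn_separated T n \<epsilon> E \<longleftrightarrow> (\<forall>x\<in>E. \<forall>y\<in>E. x \<noteq> y \<longrightarrow> dyn_dist T n x y > \<epsilon>)"

(* If X is compact, T and \<phi> are continuous, n >= 1 and \<epsilon> > 0, then the cardinalities of the
   separated sets are finite and uniformly bounded, so the sums and the real-valued supremum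
   are genuine, and the supremum is positive. *)
definition separated_sum_sup ::
    "('a::metric_space \<Rightarrow> 'a) \<Rightarrow> ('a \<Rightarrow> real) \<Rightarrow> nat \<Rightarrow> real \<Rightarrow> real" where
  "separated_sum_sup T \<phi> n \<epsilon> =
     (SUP E \<in> {E. dyn_separated T n \<epsilon> E}. \<Sum>x\<in>E. exp (birkhoff_sum T n \<phi> x))"

(* The version with the lower limit; the one with limsup has the same value. *)
definition top_pressure :: "('a::metric_space \<Rightarrow> 'a) \<Rightarrow> ('a \<Rightarrow> real) \<Rightarrow> ereal" where
  "top_pressure T \<phi> =
     Lim (at_right 0) (\<lambda>\<epsilon>. liminf (\<lambda>n. ereal (1 / real n * ln (separated_sum_sup T \<phi> n \<epsilon>))))"

(* A ball B_m(x,\<epsilon>) of a cover is recorded by its pair (x, m): the same set may be a Bowen ball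
   for several m, whereas the weight of a cover refers to m.  Centres range over all of X. *)
definition bowen_covers ::
    "('a::metric_space \<Rightarrow> 'a) \<Rightarrow> 'a set \<Rightarrow> nat \<Rightarrow> real \<Rightarrow> ('a \<times> nat) set set" where
  "bowen_covers T Z n \<epsilon> =
     {C. countable C \<and> (\<forall>(x, m)\<in>C. n \<le> m) \<and> Z \<subseteq> (\<Union>(x, m)\<in>C. bowen_ball T m x \<epsilon>)}"

definition pressure_M_n :: "('a::metric_space \<Rightarrow> 'a) \<Rightarrow> 'a set \<Rightarrow> real \<Rightarrow> ('a \<Rightarrow> real)
    \<Rightarrow> nat \<Rightarrow> real \<Rightarrow> ennreal" where
  "pressure_M_n T Z t \<phi> n \<epsilon> =
     (INF C \<in> bowen_covers T Z n \<epsilon>. \<Sum>\<^sub>\<infinity>(x, m)\<in>C.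
        ennreal (exp (- t * real m + (SUP y \<in> bowen_ball T m x \<epsilon>. birkhoff_sum T m \<phi> y))))"

definition pressure_M :: "('a::metric_space \<Rightarrow> 'a) \<Rightarrow> 'a set \<Rightarrow> real \<Rightarrow> ('a \<Rightarrow> real)
    \<Rightarrow> real \<Rightarrow> ennreal" where
  "pressure_M T Z t \<phi> \<epsilon> = lim (\<lambda>n. pressure_M_n T Z t \<phi> n \<epsilon>)"

(* The infimum over real t is taken in the extended reals, so that it is defined in all cases
   (for Z = {} it is -\<infinity>). *)
definition pressure_at_scale :: "('a::metric_space \<Rightarrow> 'a) \<Rightarrow> 'a set \<Rightarrow> ('a \<Rightarrow> real)
    \<Rightarrow> real \<Rightarrow> ereal" where
  "pressure_at_scale T Z \<phi> \<epsilon> = Inf (ereal ` {t. pressure_M T Z t \<phi> \<epsilon> = 0})"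

definition pressure_on :: "('a::metric_space \<Rightarrow> 'a) \<Rightarrow> 'a set \<Rightarrow> ('a \<Rightarrow> real) \<Rightarrow> ereal" where
  "pressure_on T Z \<phi> = Lim (at_right 0) (\<lambda>\<epsilon>. pressure_at_scale T Z \<phi> \<epsilon>)"

end

theory Submission
  imports Defs
begin

text \<open>
  The inequality \<open>\<le>\<close> holds for every set, by covers with Bowen balls around maximal separated
  sets. For \<open>\<ge>\<close>, choose \<open>u\<close> outside the closed orbit of \<open>z\<^sub>0\<close>.
  By specification and compactness, every sequence of points of an \<open>(n, 4\<epsilon>)\<close>-separated set \<open>E\<close> of
  large weight is shadowed by a point that in addition comes close to \<open>u\<close> once in every period
  \<open>L = n + 2g\<close>. Such a point lies in \<open>E(z\<^sub>0)\<close>: whenever its orbit is very close to \<open>z\<^sub>0\<close> it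
  follows the orbit of \<open>z\<^sub>0\<close>, and hence stays away from \<open>u\<close>, for longer than a period.
  A Bowen ball of length \<open>m\<close> determines the first \<open>m div L\<close> symbols of every sequence shadowed in it,
  so a cover of \<open>E(z\<^sub>0)\<close> yields a cover of the sequence space by cylinders, whose weights
  are compared along the tree of words.
\<close>

section \<open>Covers of a sequence space by cylinders\<close>

lemma ennreal_summable_on: "(f :: 'c \<Rightarrow> ennreal) summable_on S"
  by (rule nonneg_summable_on_complete) simp

text \<open>The condition \<open>take (length v) (w c) = v\<close> says that \<open>v\<close> is a
  prefix of \<open>w c\<close>. Words that continue \<open>v\<close> by distinct letters have no
  common extension, so the families on the left are disjoint parts of the family on the right.
  Indices with \<open>w c = v\<close> occur only on the right.\<close>

lemma sum_infsum_prefix_le: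
  fixes f :: "'c \<Rightarrow> ennreal"
  assumes "finite E"
  shows "(\<Sum>a\<in>E. \<Sum>\<^sub>\<infinity>c\<in>{c\<in>C. take (Suc (length v)) (w c) = v @ [a]}. f c)
    \<le> (\<Sum>\<^sub>\<infinity>c\<in>{c\<in>C. take (length v) (w c) = v}. f c)"
proof -
  have "take (length v) xs = v" if "take (Suc (length v)) xs = v @ [a]" for xs a
    using that by (metis append_eq_conv_conj append_take_drop_id append.assoc)
  then have sub: "(\<Union>a\<in>E. {c\<in>C. take (Suc (length v)) (w c) = v @ [a]})
      \<subseteq> {c\<in>C. take (length v) (w c) = v}"
    by auto
  have "(\<Sum>a\<in>E. \<Sum>\<^sub>\<infinity>c\<in>{c\<in>C. take (Suc (length v)) (w c) = v @ [a]}. f c)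
    = (\<Sum>\<^sub>\<infinity>c\<in>(\<Union>a\<in>E. {c\<in>C. take (Suc (length v)) (w c) = v @ [a]}). f c)"
    by (rule sum_infsum) (use assms in \<open>auto intro: ennreal_summable_on\<close>)
  also have "\<dots> \<le> (\<Sum>\<^sub>\<infinity>c\<in>{c\<in>C. take (length v) (w c) = v}. f c)"
    by (rule infsum_mono_neutral) (use sub in \<open>auto intro: ennreal_summable_on\<close>)
  finally show ?thesis .
qed

text \<open>
  If the cover were too cheap, one could descend from the root to ever longer words that are heavier
  than the part of the cover below them; the limit sequence would not be covered.
\<close>

lemma cylinder_cover_weight:
  fixes f :: "'c \<Rightarrow> ennreal" and W :: "'b list \<Rightarrow> ennreal"
  assumes "finite E"
    and W: "\<And>v. W v \<le> (\<Sum>a\<in>E. W (v @ [a]))"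
    and f: "\<And>c. c \<in> C \<Longrightarrow> W (w c) \<le> f c"
    and cover: "\<And>\<sigma>. (\<And>j::nat. \<sigma> j \<in> E) \<Longrightarrow> \<exists>c\<in>C. w c = map \<sigma> [0..<length (w c)]"
  shows "W [] \<le> infsum f C"
proof (rule ccontr)
  \<comment> \<open>Cost of the part of the cover below \<open>v\<close>; elements whose word is a
    proper prefix of \<open>v\<close> are not counted.\<close>
  define \<mu> where "\<mu> v = (\<Sum>\<^sub>\<infinity>c\<in>{c\<in>C. take (length v) (w c) = v}. f c)" for v
  assume "\<not> W [] \<le> infsum f C"
  then have root: "\<mu> [] < W []"
    by (simp add: \<mu>_def)
  have step: "\<exists>a\<in>E. \<mu> (v @ [a]) < W (v @ [a])" if "\<mu> v < W v" for v
  proof (rule ccontr)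
    assume "\<not> ?thesis"
    then have "(\<Sum>a\<in>E. W (v @ [a])) \<le> (\<Sum>a\<in>E. \<mu> (v @ [a]))"
      by (intro sum_mono) (auto simp: not_less)
    also have "\<dots> \<le> \<mu> v"
      using sum_infsum_prefix_le[OF \<open>finite E\<close>, where v = v and w = w and f = f and C = C] by (simp add: \<mu>_def)
    finally show False
      using W[of v] that by auto
  qed
  define next_letter where "next_letter v = (SOME a. a \<in> E \<and> \<mu> (v @ [a]) < W (v @ [a]))" for v
  have next_letter: "next_letter v \<in> E \<and> \<mu> (v @ [next_letter v]) < W (v @ [next_letter v])"
    if "\<mu> v < W v" for v
    unfolding next_letter_def by (rule someI_ex) (use step[OF that] in auto)
  define V where "V j = ((\<lambda>v. v @ [next_letter v]) ^^ j) []" for j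
  have V_Suc: "V (Suc j) = V j @ [next_letter (V j)]" for j
    by (simp add: V_def)
  have heavy: "\<mu> (V j) < W (V j)" for j
    by (induction j) (use root next_letter V_Suc in \<open>auto simp: V_def\<close>)
  define \<sigma> where "\<sigma> j = next_letter (V j)" for j
  have V_map: "V j = map \<sigma> [0..<j]" for j
    by (induction j) (simp_all add: V_Suc \<sigma>_def, simp add: V_def)
  obtain c where c: "c \<in> C" "w c = map \<sigma> [0..<length (w c)]"
    using cover[of \<sigma>] next_letter heavy by (auto simp: \<sigma>_def)
  \<comment> \<open>The word of \<open>c\<close> lies on the branch followed by
    \<open>\<sigma>\<close>, so \<open>c\<close> is counted in \<open>\<mu> v\<close> and
    \<open>W v \<le> f c \<le> \<mu> v\<close>, although this branch is heavy everywhere.\<close>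
  define v where "v = w c"
  have "v = V (length (w c))"
    using c V_map v_def by simp
  then have "\<mu> v < W v"
    using heavy by metis
  moreover have "f c \<le> \<mu> v"
  proof -
    have "f c = infsum f {c}"
      by simp
    also have "\<dots> \<le> \<mu> v"
      unfolding \<mu>_def by (rule infsum_mono_neutral) (use c in \<open>auto simp: v_def intro: ennreal_summable_on\<close>)
    finally show ?thesis .
  qed
  ultimately show False
    using f[OF c(1)] by (auto simp: v_def)
qed

section \<open>Dynamical distance and specification for infinitely many orbit segments\<close>

lemma dyn_dist_less_iff: "0 < n \<Longrightarrow> dyn_dist T n x y < \<epsilon> \<longleftrightarrow> (\<forall>i<n. dist ((T ^^ i) x) ((T ^^ i) y) < \<epsilon>)"
  by (subst dyn_dist_def, subst Max_less_iff) auto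

lemma less_dyn_dist_iff: "0 < n \<Longrightarrow> \<epsilon> < dyn_dist T n x y \<longleftrightarrow> (\<exists>i<n. \<epsilon> < dist ((T ^^ i) x) ((T ^^ i) y))"
  by (subst dyn_dist_def, subst Max_gr_iff) auto

lemma mem_bowen_ball_iff: "0 < n \<Longrightarrow> y \<in> bowen_ball T n x \<epsilon> \<longleftrightarrow> (\<forall>i<n. dist ((T ^^ i) x) ((T ^^ i) y) < \<epsilon>)"
  by (simp add: bowen_ball_def dyn_dist_less_iff)

lemma centre_mem_bowen_ball: "0 < n \<Longrightarrow> 0 < \<epsilon> \<Longrightarrow> x \<in> bowen_ball T n x \<epsilon>"
  by (simp add: mem_bowen_ball_iff)

lemma continuous_on_funpow:
  "continuous_on UNIV T \<Longrightarrow> continuous_on UNIV (T ^^ i)" for T :: "'a::topological_space \<Rightarrow> 'a"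
proof (induction i)
  case (Suc i)
  then show ?case
    using continuous_on_compose[of UNIV "T ^^ i" T] by (auto simp: o_def intro: continuous_on_subset)
qed (auto simp: continuous_on_id id_def)

lemma birkhoff_sum_add:
  "birkhoff_sum T (m + n) \<phi> x = birkhoff_sum T m \<phi> x + birkhoff_sum T n \<phi> ((T ^^ m) x)"
proof -
  have "(\<Sum>i<m + n. \<phi> ((T ^^ i) x)) = (\<Sum>i<m. \<phi> ((T ^^ i) x)) + (\<Sum>i<n. \<phi> ((T ^^ (m + i)) x))"
    by (induction n) auto
  then show ?thesis
    by (simp add: birkhoff_sum_def add.commute[of m] funpow_add)
qed

lemma birkhoff_sum_diff_le:
  assumes "\<And>i. i < n \<Longrightarrow> \<phi> ((T ^^ i) x) - \<phi> ((T ^^ i) y) \<le> \<eta>"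
  shows "birkhoff_sum T n \<phi> x - birkhoff_sum T n \<phi> y \<le> real n * \<eta>"
proof -
  have "birkhoff_sum T n \<phi> x - birkhoff_sum T n \<phi> y = (\<Sum>i<n. \<phi> ((T ^^ i) x) - \<phi> ((T ^^ i) y))"
    by (simp add: birkhoff_sum_def sum_subtractf)
  also have "\<dots> \<le> (\<Sum>i<n. \<eta>)"
    by (rule sum_mono) (use assms in auto)
  finally show ?thesis
    by simp
qed

lemma abs_birkhoff_sum_le:
  assumes "\<And>x. \<bar>\<phi> x\<bar> \<le> B"
  shows "\<bar>birkhoff_sum T n \<phi> x\<bar> \<le> real n * B"
proof -
  have "\<bar>birkhoff_sum T n \<phi> x\<bar> \<le> (\<Sum>i<n. \<bar>\<phi> ((T ^^ i) x)\<bar>)"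
    unfolding birkhoff_sum_def by (rule sum_abs)
  also have "\<dots> \<le> (\<Sum>i<n. B)"
    by (rule sum_mono) (use assms in auto)
  finally show ?thesis
    by simp
qed

text \<open>Specification gives a point for each finite initial family of segments. A limit point of
  these serves all segments at once, since every single inequality concerns one iterate and passes
  to the limit; the strict bound becomes \<open>\<le> \<epsilon>\<close>.\<close>

lemma specification_infinite:
  fixes T :: "'a::metric_space \<Rightarrow> 'a"
  assumes compact: "compact (UNIV :: 'a set)" and cont: "continuous_on UNIV T"
    and spec: "specification_property T" and "0 < \<epsilon>"
  obtains g where "\<And>a b xs. (\<And>j::nat. a j \<le> b j) \<Longrightarrow> (\<And>j. b j + g \<le> a (Suc j)) \<Longrightarrow>
    \<exists>x. \<forall>j. \<forall>p\<le>b j - a j. dist ((T ^^ (p + a j)) x) ((T ^^ p) (xs j)) \<le> \<epsilon>"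
proof -
  from spec[unfolded specification_property_def, rule_format, OF \<open>0 < \<epsilon>\<close>]
  obtain g where g: "\<And>k a b xs. (\<forall>j\<in>{1..k}. a j \<le> b j) \<and> (\<forall>j\<in>{1..<k}. b j + g \<le> a (Suc j)) \<Longrightarrow>
        \<exists>x. \<forall>j\<in>{1..k}. \<forall>p\<in>{0..b j - a j}. dist ((T ^^ (p + a j)) x) ((T ^^ p) (xs j)) < \<epsilon>"
    by blast
  have "\<exists>x. \<forall>j. \<forall>p\<le>b j - a j. dist ((T ^^ (p + a j)) x) ((T ^^ p) (xs j)) \<le> \<epsilon>"
    if ab: "\<And>j. a j \<le> b j" and gap: "\<And>j. b j + g \<le> a (Suc j)" for a b xs
  proof -
    have "\<exists>x. \<forall>j<k. \<forall>p\<le>b j - a j. dist ((T ^^ (p + a j)) x) ((T ^^ p) (xs j)) < \<epsilon>" for k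
    proof -
      \<comment> \<open>The specification property numbers segments from 1, while they are numbered
        from 0 here.\<close>
      have "\<forall>j\<in>{1..<k}. b (j - 1) + g \<le> a (Suc j - 1)"
      proof
        fix j assume "j \<in> {1..<k}"
        then show "b (j - 1) + g \<le> a (Suc j - 1)"
          using gap[of "j - 1"] by simp
      qed
      then have "\<exists>x. \<forall>j\<in>{1..k}. \<forall>p\<in>{0..b (j - 1) - a (j - 1)}.
          dist ((T ^^ (p + a (j - 1))) x) ((T ^^ p) (xs (j - 1))) < \<epsilon>"
        by (intro g) (use ab in auto)
      then obtain x where x: "\<forall>j\<in>{1..k}. \<forall>p\<in>{0..b (j - 1) - a (j - 1)}.
          dist ((T ^^ (p + a (j - 1))) x) ((T ^^ p) (xs (j - 1))) < \<epsilon>" ..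
      have "\<forall>p\<le>b j - a j. dist ((T ^^ (p + a j)) x) ((T ^^ p) (xs j)) < \<epsilon>" if "j < k" for j
        using x[rule_format, of "Suc j"] that by auto
      then show ?thesis
        by blast
    qed
    then obtain X where X: "\<And>k j p. j < k \<Longrightarrow> p \<le> b j - a j \<Longrightarrow>
        dist ((T ^^ (p + a j)) (X k)) ((T ^^ p) (xs j)) < \<epsilon>"
      by metis
    obtain x r where r: "strict_mono (r :: nat \<Rightarrow> nat)" and lim: "(X \<circ> r) \<longlonglongrightarrow> x"
      using compact_imp_seq_compact[OF compact] unfolding seq_compact_def by blast
    have "dist ((T ^^ (p + a j)) x) ((T ^^ p) (xs j)) \<le> \<epsilon>" if "p \<le> b j - a j" for j p
    proof -
      have "isCont (T ^^ (p + a j)) x"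
        using continuous_on_funpow[OF cont] by (simp add: continuous_on_eq_continuous_at)
      then have "(\<lambda>k. (T ^^ (p + a j)) (X (r k))) \<longlonglongrightarrow> (T ^^ (p + a j)) x"
        using lim isCont_tendsto_compose[of x "T ^^ (p + a j)"] by (auto simp: o_def)
      then have "(\<lambda>k. dist ((T ^^ (p + a j)) (X (r k))) ((T ^^ p) (xs j)))
          \<longlonglongrightarrow> dist ((T ^^ (p + a j)) x) ((T ^^ p) (xs j))"
        by (intro tendsto_intros)
      \<comment> \<open>Only the points \<open>X k\<close> with \<open>k > j\<close> are known to
        shadow segment \<open>j\<close>; along the subsequence this holds from \<open>Suc j\<close>
        on because \<open>k \<le> r k\<close>.\<close>
      moreover have "\<forall>k\<ge>Suc j. dist ((T ^^ (p + a j)) (X (r k))) ((T ^^ p) (xs j)) \<le> \<epsilon>"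
      proof (intro allI impI)
        fix k assume "Suc j \<le> k"
        then have "j < r k"
          using seq_suble[OF r, of k] by linarith
        then show "dist ((T ^^ (p + a j)) (X (r k))) ((T ^^ p) (xs j)) \<le> \<epsilon>"
          using X[of j "r k" p] that by simp
      qed
      ultimately show ?thesis
        by (rule LIMSEQ_le_const2[OF _ exI])
    qed
    then show ?thesis
      by blast
  qed
  then show ?thesis
    by (rule that)
qed

text \<open>A visit near \<open>u\<close> is inserted once per period \<open>n + 2 * g\<close>. The
  gap \<open>g\<close> is fixed before \<open>n\<close>, so that its cost can later be made
  negligible by long words.\<close>

lemma shadowing_avoiding:
  fixes T :: "'a::metric_space \<Rightarrow> 'a"
  assumes compact: "compact (UNIV :: 'a set)" and cont: "continuous_on UNIV T"
    and spec: "specification_property T" and "closure (forward_orbit T z0) \<noteq> UNIV" and "0 < \<epsilon>"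
  obtains g where "\<And>n \<sigma>. 0 < n \<Longrightarrow> \<exists>x\<in>non_dense_orbit_set T z0.
    \<forall>j. \<forall>i<n. dist ((T ^^ (i + j * (n + 2 * g))) x) ((T ^^ i) (\<sigma> j)) \<le> \<epsilon>"
proof -
  obtain u where "u \<notin> closure (forward_orbit T z0)"
    using assms by auto
  then obtain \<delta> where \<delta>: "0 < \<delta>" "\<And>y. y \<in> forward_orbit T z0 \<Longrightarrow> \<delta> \<le> dist y u"
    unfolding closure_approachable by (meson not_less)
  \<comment> \<open>Tolerance \<open>\<delta> / 3\<close> at the visits to \<open>u\<close> and
    again in the neighbourhood of \<open>z0\<close> adds up to less than
    \<open>\<delta>\<close>.\<close>
  define \<epsilon>' where "\<epsilon>' = min \<epsilon> (\<delta> / 3)"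
  have "0 < \<epsilon>'" "\<epsilon>' \<le> \<epsilon>" "\<epsilon>' \<le> \<delta> / 3"
    using \<delta> \<open>0 < \<epsilon>\<close> by (auto simp: \<epsilon>'_def)
  obtain g where g: "\<And>a b xs. (\<And>j::nat. a j \<le> b j) \<Longrightarrow> (\<And>j. b j + g \<le> a (Suc j)) \<Longrightarrow>
    \<exists>x. \<forall>j. \<forall>p\<le>b j - a j. dist ((T ^^ (p + a j)) x) ((T ^^ p) (xs j)) \<le> \<epsilon>'"
    using specification_infinite[OF compact cont spec \<open>0 < \<epsilon>'\<close>] by blast
  have "\<exists>x\<in>non_dense_orbit_set T z0.
    \<forall>j. \<forall>i<n. dist ((T ^^ (i + j * (n + 2 * g))) x) ((T ^^ i) (\<sigma> j)) \<le> \<epsilon>" if n: "0 < n" for n \<sigma>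
  proof -
    define L where "L = n + 2 * g"
    \<comment> \<open>Even indices carry the words, at times \<open>j * L\<close> to
      \<open>j * L + n - 1\<close>; odd indices carry the single time of a visit to
      \<open>u\<close>, with a gap of at least \<open>g\<close> on either side.\<close>
    define a where "a i = (i div 2) * L + (if even i then 0 else n + g)" for i
    define b where "b i = a i + (if even i then n - 1 else 0)" for i
    define xs where "xs i = (if even i then \<sigma> (i div 2) else u)" for i
    have "\<exists>x. \<forall>j. \<forall>p\<le>b j - a j. dist ((T ^^ (p + a j)) x) ((T ^^ p) (xs j)) \<le> \<epsilon>'"
    proof (rule g)
      show "a j \<le> b j" for j
        by (simp add: b_def)
      show "b j + g \<le> a (Suc j)" for j
        using n by (cases "even j") (auto simp: b_def a_def L_def elim!: evenE oddE)
    qed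
    then obtain x where x: "\<And>j p. p \<le> b j - a j \<Longrightarrow> dist ((T ^^ (p + a j)) x) ((T ^^ p) (xs j)) \<le> \<epsilon>'"
      by blast
    have word: "dist ((T ^^ (i + j * L)) x) ((T ^^ i) (\<sigma> j)) \<le> \<epsilon>'" if "i < n" for i j
      using x[of i "2 * j"] that by (simp add: a_def b_def xs_def)
    have visit: "dist ((T ^^ (j * L + (n + g))) x) u \<le> \<epsilon>'" for j
      using x[of 0 "2 * j + 1"] by (simp add: a_def b_def xs_def)
    \<comment> \<open>Points that follow \<open>z0\<close> up to time \<open>2 * L\<close>, which is
      long enough to include a visit to \<open>u\<close> from any starting phase.\<close>
    define U where "U = (\<Inter>i\<in>{..2 * L}. (T ^^ i) -` ball ((T ^^ i) z0) (\<delta> / 3))"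
    have "open U"
      unfolding U_def using continuous_on_funpow[OF cont]
      by (auto intro!: open_INT open_vimage)
    moreover have "z0 \<in> U"
      using \<delta> by (simp add: U_def)
    moreover have "forward_orbit T x \<inter> U = {}"
    proof (rule ccontr)
      assume "forward_orbit T x \<inter> U \<noteq> {}"
      then obtain t where t: "(T ^^ t) x \<in> U"
        by (auto simp: forward_orbit_def)
      have "n + g \<le> L"
        by (simp add: L_def)
      \<comment> \<open>Waiting time from \<open>t\<close> until the visit in the next period, as
        the visit of the current period may be over. The subtraction is exact because
        \<open>t\<close> precedes the next period.\<close>
      define s where "s = Suc (t div L) * L + (n + g) - t"
      have L: "t div L * L \<le> t" "t < Suc (t div L) * L"
        using n dividend_less_div_times[of L t] by (auto simp: L_def)
      then have st: "s + t = Suc (t div L) * L + (n + g)"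
        by (simp add: s_def)
      have "s \<le> 2 * L"
        using st L(1) \<open>n + g \<le> L\<close> unfolding mult_Suc by linarith
      then have "dist ((T ^^ s) z0) ((T ^^ (s + t)) x) < \<delta> / 3"
        using t by (auto simp: U_def funpow_add)
      moreover have "dist ((T ^^ (s + t)) x) u \<le> \<delta> / 3"
        using visit[of "Suc (t div L)"] \<open>\<epsilon>' \<le> \<delta> / 3\<close> unfolding st by linarith
      moreover have "\<delta> \<le> dist ((T ^^ s) z0) u"
        using \<delta>(2) by (simp add: forward_orbit_def)
      ultimately show False
        using \<delta>(1) dist_triangle[of "(T ^^ s) z0" u "(T ^^ (s + t)) x"] by linarith
    qed
    ultimately have "z0 \<notin> closure (forward_orbit T x)"
      by (metis disjoint_iff open_Int_closure_eq_empty Int_commute)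
    then have "x \<in> non_dense_orbit_set T z0"
      by (simp add: non_dense_orbit_set_def)
    with word \<open>\<epsilon>' \<le> \<epsilon>\<close> show ?thesis
      unfolding L_def by (meson order_trans)
  qed
  then show ?thesis
    by (rule that)
qed

section \<open>Comparison of the pressures at a fixed scale\<close>

locale compact_system =
  fixes T :: "'a::metric_space \<Rightarrow> 'a" and \<phi> :: "'a \<Rightarrow> real"
  assumes compact_UNIV: "compact (UNIV :: 'a set)"
    and continuous_T: "continuous_on UNIV T"
    and continuous_potential: "continuous_on UNIV \<phi>"
begin

section \<open>Bounds for the potential and for separated sets\<close>

lemma potential_bounded:
  obtains B where "\<And>x. \<bar>\<phi> x\<bar> \<le> B"
proof -
  have "bounded (range \<phi>)"
    using compact_continuous_image[OF continuous_potential compact_UNIV] compact_imp_bounded by blast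
  then show ?thesis
    using that by (auto simp: bounded_iff)
qed

lemma potential_modulus:
  assumes "0 < \<eta>"
  obtains \<delta> where "0 < \<delta>" "\<And>x y. dist x y < \<delta> \<Longrightarrow> \<bar>\<phi> x - \<phi> y\<bar> \<le> \<eta>"
proof -
  have "uniformly_continuous_on UNIV \<phi>"
    using compact_uniformly_continuous continuous_potential compact_UNIV by blast
  then show ?thesis
    using that assms unfolding uniformly_continuous_on_def dist_real_def
    by (metis UNIV_I dist_commute less_imp_le)
qed

lemma bdd_above_birkhoff_sum: "bdd_above (birkhoff_sum T n \<phi> ` A)"
proof -
  obtain B where "\<And>x. \<bar>\<phi> x\<bar> \<le> B"
    using potential_bounded by blast
  then have "birkhoff_sum T n \<phi> x \<le> real n * B" for x
    by (meson abs_birkhoff_sum_le abs_le_D1)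
  then show ?thesis
    by (auto intro!: bdd_aboveI[of _ "real n * B"])
qed

lemma open_bowen_ball: "0 < n \<Longrightarrow> open (bowen_ball T n x \<epsilon>)"
proof -
  assume "0 < n"
  then have "bowen_ball T n x \<epsilon> = (\<Inter>i\<in>{..<n}. (T ^^ i) -` ball ((T ^^ i) x) \<epsilon>)"
    by (auto simp: mem_bowen_ball_iff)
  then show ?thesis
    using continuous_on_funpow[OF continuous_T] by (auto intro!: open_INT open_vimage)
qed

text \<open>A Bowen ball of radius \<open>\<epsilon> / 2\<close> contains at most one point of a
  separated set, so the size of a finite cover by such balls is a bound for all separated sets
  simultaneously.\<close>

lemma dyn_separated_card_bound:
  assumes "0 < n" "0 < \<epsilon>"
  obtains K where "\<And>E. dyn_separated T n \<epsilon> E \<Longrightarrow> finite E \<and> card E \<le> K"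
proof -
  obtain D where D: "finite D" "UNIV \<subseteq> (\<Union>x\<in>D. bowen_ball T n x (\<epsilon> / 2))"
    using compactE_image[OF compact_UNIV, of UNIV "\<lambda>x. bowen_ball T n x (\<epsilon> / 2)"]
      open_bowen_ball centre_mem_bowen_ball[of n "\<epsilon> / 2"] assms
    by (metis UN_I UNIV_I half_gt_zero subsetI)
  then obtain c where c: "\<And>y. c y \<in> D" "\<And>y. y \<in> bowen_ball T n (c y) (\<epsilon> / 2)"
    unfolding subset_iff UN_iff by (metis UNIV_I)
  have "finite E \<and> card E \<le> card D" if E: "dyn_separated T n \<epsilon> E" for E
  proof -
    have "inj_on c E"
    proof (rule inj_onI, rule ccontr)
      fix x y assume xy: "x \<in> E" "y \<in> E" "c x = c y" "x \<noteq> y"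
      then obtain i where i: "i < n" "\<epsilon> < dist ((T ^^ i) x) ((T ^^ i) y)"
        using E \<open>0 < n\<close> by (auto simp: dyn_separated_def less_dyn_dist_iff)
      have "dist ((T ^^ i) (c x)) ((T ^^ i) x) < \<epsilon> / 2" "dist ((T ^^ i) (c x)) ((T ^^ i) y) < \<epsilon> / 2"
        using c(2)[of x] c(2)[of y] xy(3) i(1) \<open>0 < n\<close> by (auto simp: mem_bowen_ball_iff)
      then show False
        using i(2) dist_triangle3[of "(T ^^ i) x" "(T ^^ i) y" "(T ^^ i) (c x)"] by linarith
    qed
    then show ?thesis
      using c(1) D(1) by (meson card_inj_on_le image_subsetI inj_on_finite)
  qed
  then show ?thesis
    by (rule that)
qed

lemma bdd_above_separated_sums:
  assumes "0 < n" "0 < \<epsilon>"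
  shows "bdd_above ((\<lambda>E. \<Sum>x\<in>E. exp (birkhoff_sum T n \<phi> x)) ` {E. dyn_separated T n \<epsilon> E})"
proof -
  obtain B where B: "\<And>x. \<bar>\<phi> x\<bar> \<le> B"
    using potential_bounded by blast
  obtain K where K: "\<And>E. dyn_separated T n \<epsilon> E \<Longrightarrow> finite E \<and> card E \<le> K"
    using dyn_separated_card_bound[OF assms] by blast
  have "(\<Sum>x\<in>E. exp (birkhoff_sum T n \<phi> x)) \<le> real K * exp (real n * B)" if "dyn_separated T n \<epsilon> E" for E
  proof -
    have "exp (birkhoff_sum T n \<phi> x) \<le> exp (real n * B)" for x
      using abs_birkhoff_sum_le[of \<phi> B T n x, OF B] by auto
    then have "(\<Sum>x\<in>E. exp (birkhoff_sum T n \<phi> x)) \<le> real (card E) * exp (real n * B)"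
      by (intro sum_bounded_above)
    also have "\<dots> \<le> real K * exp (real n * B)"
      using K[OF that] by (intro mult_right_mono) auto
    finally show ?thesis .
  qed
  then show ?thesis
    unfolding bdd_above_def by blast
qed

lemma separated_sum_le:
  assumes "0 < n" "0 < \<epsilon>" "dyn_separated T n \<epsilon> E"
  shows "(\<Sum>x\<in>E. exp (birkhoff_sum T n \<phi> x)) \<le> separated_sum_sup T \<phi> n \<epsilon>"
  unfolding separated_sum_sup_def
  by (rule cSUP_upper) (use bdd_above_separated_sums assms in auto)

lemma separated_sum_sup_pos:
  assumes "0 < n" "0 < \<epsilon>"
  shows "0 < separated_sum_sup T \<phi> n \<epsilon>"
proof -
  \<comment> \<open>Singletons are separated; \<open>undefined\<close> serves as an arbitrary point
    of the phase space.\<close>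
  have "(\<Sum>x\<in>{undefined}. exp (birkhoff_sum T n \<phi> x)) \<le> separated_sum_sup T \<phi> n \<epsilon>"
    by (rule separated_sum_le) (use assms in \<open>auto simp: dyn_separated_def\<close>)
  then show ?thesis
    by (simp add: less_le_trans[OF exp_gt_zero])
qed

section \<open>Growth rate of the separated sums as a function of the scale\<close>

definition growth :: "real \<Rightarrow> ereal" where
  "growth \<epsilon> = liminf (\<lambda>n. ereal (1 / real n * ln (separated_sum_sup T \<phi> n \<epsilon>)))"

lemma growth_antimono:
  assumes "0 < \<epsilon>" "\<epsilon> \<le> \<delta>"
  shows "growth \<delta> \<le> growth \<epsilon>"
  unfolding growth_def
proof (rule Liminf_mono, rule eventually_mono[OF eventually_gt_at_top[of 0]])
  fix n :: nat assume "0 < n"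
  have "separated_sum_sup T \<phi> n \<delta> \<le> separated_sum_sup T \<phi> n \<epsilon>"
    unfolding separated_sum_sup_def
  proof (rule cSUP_subset_mono)
    show "{E. dyn_separated T n \<delta> E} \<noteq> {}"
      by (auto simp: dyn_separated_def)
    show "{E. dyn_separated T n \<delta> E} \<subseteq> {E. dyn_separated T n \<epsilon> E}"
      using assms by (fastforce simp: dyn_separated_def)
  qed (use bdd_above_separated_sums \<open>0 < n\<close> assms in auto)
  then show "ereal (1 / real n * ln (separated_sum_sup T \<phi> n \<delta>))
      \<le> ereal (1 / real n * ln (separated_sum_sup T \<phi> n \<epsilon>))"
    using separated_sum_sup_pos \<open>0 < n\<close> assms by (auto intro!: divide_right_mono)
qed

text \<open>Since \<open>growth\<close> increases as the scale shrinks, its right limit at 0 is the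
  supremum over all scales. Thus the \<open>Lim\<close> in \<open>top_pressure\<close> is a genuine
  limit.\<close>

lemma tendsto_growth: "(growth \<longlongrightarrow> (SUP \<epsilon>\<in>{0<..}. growth \<epsilon>)) (at_right 0)"
proof (rule order_tendstoI)
  fix a assume "a < (SUP \<epsilon>\<in>{0<..}. growth \<epsilon>)"
  then obtain e where e: "0 < e" "a < growth e"
    by (auto simp: less_SUP_iff)
  have "eventually (\<lambda>\<epsilon>. \<epsilon> \<in> {0<..<e}) (at_right 0)"
    using e(1) by (rule eventually_at_right_real)
  then show "eventually (\<lambda>\<epsilon>. a < growth \<epsilon>) (at_right 0)"
    by eventually_elim (use e(2) growth_antimono in \<open>force intro: less_le_trans\<close>)
next
  fix a assume "(SUP \<epsilon>\<in>{0<..}. growth \<epsilon>) < a"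
  then have "growth \<epsilon> < a" if "0 < \<epsilon>" for \<epsilon>
    using that by (meson SUP_upper greaterThan_iff le_less_trans)
  then show "eventually (\<lambda>\<epsilon>. growth \<epsilon> < a) (at_right 0)"
    by (auto simp: eventually_at_right_field intro: exI[of _ 1])
qed

lemma top_pressure_eq: "top_pressure T \<phi> = (SUP \<epsilon>\<in>{0<..}. growth \<epsilon>)"
  unfolding top_pressure_def growth_def[symmetric]
  by (rule tendsto_Lim[OF _ tendsto_growth]) simp

section \<open>Estimates for the pressure of sets at a fixed scale\<close>

lemma pressure_M_eq_SUP: "pressure_M T Z t \<phi> \<epsilon> = (SUP n. pressure_M_n T Z t \<phi> n \<epsilon>)"
  unfolding pressure_M_def
proof (rule limI, rule LIMSEQ_SUP, rule incseq_SucI)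
  show "pressure_M_n T Z t \<phi> n \<epsilon> \<le> pressure_M_n T Z t \<phi> (Suc n) \<epsilon>" for n
    unfolding pressure_M_n_def by (rule INF_superset_mono) (fastforce simp: bowen_covers_def)+
qed

text \<open>A separated set of largest cardinality cannot be enlarged, so every point has dynamical
  distance at most \<open>\<epsilon>\<close> from it. Bowen balls are defined by a strict
  inequality, hence the larger radius \<open>\<delta>\<close>.\<close>

lemma separated_spanning:
  assumes "0 < n" "0 < \<epsilon>"
  obtains E where "finite E" "dyn_separated T n \<epsilon> E"
    "\<And>\<delta>. \<epsilon> < \<delta> \<Longrightarrow> (\<Union>x\<in>E. bowen_ball T n x \<delta>) = UNIV"
proof -
  obtain K where K: "\<And>E. dyn_separated T n \<epsilon> E \<Longrightarrow> finite E \<and> card E \<le> K"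
    using dyn_separated_card_bound[OF assms] by blast
  have "\<exists>E. dyn_separated T n \<epsilon> E \<and> (\<forall>E'. dyn_separated T n \<epsilon> E' \<longrightarrow> card E' \<le> card E)"
    by (rule ex_has_greatest_nat[where k = "{}" and b = "Suc K"]) (use K in \<open>auto simp: dyn_separated_def less_Suc_eq_le\<close>)
  then obtain E where E: "dyn_separated T n \<epsilon> E" "\<And>E'. dyn_separated T n \<epsilon> E' \<Longrightarrow> card E' \<le> card E"
    by blast
  have "finite E"
    using K E by blast
  have "\<exists>x\<in>E. y \<in> bowen_ball T n x \<delta>" if "\<epsilon> < \<delta>" for y \<delta>
  proof (rule ccontr)
    assume far: "\<not> ?thesis"
    then have "\<forall>x\<in>E. \<epsilon> < dyn_dist T n x y"
      using that by (auto simp: bowen_ball_def)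
    moreover from this have "\<forall>x\<in>E. \<epsilon> < dyn_dist T n y x"
      by (simp add: dyn_dist_def dist_commute)
    ultimately have "dyn_separated T n \<epsilon> (insert y E)"
      using E(1) by (auto simp: dyn_separated_def)
    then have "y \<in> E"
      using E(2)[of "insert y E"] \<open>finite E\<close> by (auto simp: card_insert_if split: if_splits)
    then show False
      using far centre_mem_bowen_ball[of n \<delta> y T] assms that by auto
  qed
  then show ?thesis
    using that \<open>finite E\<close> E(1) by blast
qed

text \<open>Balls of one length \<open>n\<close> around a maximal
  \<open>(n, \<epsilon> / 2)\<close>-separated set cover everything. Replacing the supremum over a
  ball by the value at its centre costs \<open>\<eta>\<close> per step, so the weight is at most
  \<open>exp (- (t - \<eta> - s) * n)\<close> whenever the separated sum grows slower than
  \<open>exp (n * s)\<close>.\<close>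

lemma pressure_at_scale_le:
  assumes "0 < \<epsilon>" and modulus: "\<And>x y. dist x y < \<epsilon> \<Longrightarrow> \<bar>\<phi> x - \<phi> y\<bar> \<le> \<eta>"
    and s: "growth (\<epsilon> / 2) < ereal s"
  shows "pressure_at_scale T Z \<phi> \<epsilon> \<le> ereal (s + \<eta>)"
proof -
  have "pressure_M T Z t \<phi> \<epsilon> = 0" if t: "s + \<eta> < t" for t
  proof -
    have small: "pressure_M_n T Z t \<phi> N \<epsilon> \<le> ennreal (exp (- (t - \<eta> - s) * real n))"
      if n: "N \<le> n" "0 < n" "1 / real n * ln (separated_sum_sup T \<phi> n (\<epsilon> / 2)) < s" for n N
    proof -
      obtain E where E: "finite E" "dyn_separated T n (\<epsilon> / 2) E"
        and span: "(\<Union>x\<in>E. bowen_ball T n x \<epsilon>) = UNIV"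
      proof (rule separated_spanning[of n "\<epsilon> / 2"])
        fix E assume "finite E" "dyn_separated T n (\<epsilon> / 2) E"
          "\<And>\<delta>. \<epsilon> / 2 < \<delta> \<Longrightarrow> (\<Union>x\<in>E. bowen_ball T n x \<delta>) = UNIV"
        then show thesis
          using \<open>0 < \<epsilon>\<close> by (intro that) auto
      qed (use \<open>0 < n\<close> \<open>0 < \<epsilon>\<close> in auto)
      have "E \<times> {n} \<in> bowen_covers T Z N \<epsilon>"
        using E(1) span n(1) by (auto simp: bowen_covers_def intro: countable_finite)
      then have "pressure_M_n T Z t \<phi> N \<epsilon> \<le> (\<Sum>\<^sub>\<infinity>(x, m)\<in>E \<times> {n}.
          ennreal (exp (- t * real m + (SUP y \<in> bowen_ball T m x \<epsilon>. birkhoff_sum T m \<phi> y))))"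
        unfolding pressure_M_n_def by (rule INF_lower)
      also have "\<dots> = (\<Sum>x\<in>E. ennreal (exp (- t * real n + (SUP y \<in> bowen_ball T n x \<epsilon>. birkhoff_sum T n \<phi> y))))"
        using E(1) by (simp add: sum.cartesian_product[symmetric])
      also have "\<dots> \<le> (\<Sum>x\<in>E. ennreal (exp (- t * real n + (birkhoff_sum T n \<phi> x + real n * \<eta>))))"
      proof (intro sum_mono ennreal_leI exp_le_cancel_iff[THEN iffD2] add_left_mono cSUP_least)
        fix x y assume "y \<in> bowen_ball T n x \<epsilon>"
        then have "birkhoff_sum T n \<phi> y - birkhoff_sum T n \<phi> x \<le> real n * \<eta>"
          using modulus \<open>0 < n\<close>
          by (intro birkhoff_sum_diff_le) (force simp: mem_bowen_ball_iff dist_commute abs_le_iff)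
        then show "birkhoff_sum T n \<phi> y \<le> birkhoff_sum T n \<phi> x + real n * \<eta>"
          by simp
      qed (use centre_mem_bowen_ball \<open>0 < n\<close> \<open>0 < \<epsilon>\<close> in blast)
      also have "\<dots> = ennreal (exp (- (t - \<eta>) * real n) * (\<Sum>x\<in>E. exp (birkhoff_sum T n \<phi> x)))"
        by (simp add: sum_ennreal sum_distrib_right exp_add[symmetric] algebra_simps)
      also have "\<dots> \<le> ennreal (exp (- (t - \<eta>) * real n) * exp (real n * s))"
      proof (intro ennreal_leI mult_left_mono)
        have "ln (separated_sum_sup T \<phi> n (\<epsilon> / 2)) < real n * s"
          using n by (simp add: field_simps)
        then have "separated_sum_sup T \<phi> n (\<epsilon> / 2) < exp (real n * s)"
          using separated_sum_sup_pos[of n "\<epsilon> / 2"] \<open>0 < n\<close> \<open>0 < \<epsilon>\<close>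
          by (metis exp_less_cancel_iff exp_ln half_gt_zero)
        then show "(\<Sum>x\<in>E. exp (birkhoff_sum T n \<phi> x)) \<le> exp (real n * s)"
          using separated_sum_le[of n "\<epsilon> / 2" E] E \<open>0 < n\<close> \<open>0 < \<epsilon>\<close> by auto
      qed simp
      also have "\<dots> = ennreal (exp (- (t - \<eta> - s) * real n))"
        by (simp add: exp_add[symmetric] algebra_simps)
      finally show ?thesis .
    qed
    \<comment> \<open>A lower limit below \<open>s\<close> provides good lengths \<open>n\<close>
      only infinitely often.\<close>
    have freq: "\<exists>n\<ge>N. 1 / real n * ln (separated_sum_sup T \<phi> n (\<epsilon> / 2)) < s" for N
    proof (rule ccontr)
      assume "\<not> ?thesis"
      then have "ereal s \<le> growth (\<epsilon> / 2)"
        unfolding growth_def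
        by (intro Liminf_bounded) (auto simp: eventually_sequentially not_less)
      with s show False
        by simp
    qed
    have "pressure_M_n T Z t \<phi> N \<epsilon> = 0" for N
    proof -
      \<comment> \<open>The bound decreases in \<open>n\<close>, so the one at a later good length
        \<open>n'\<close> implies the one at \<open>n\<close>.\<close>
      have "pressure_M_n T Z t \<phi> N \<epsilon> \<le> ennreal (exp (- (t - \<eta> - s) * real n))" if "N \<le> n" "0 < n" for n
      proof -
        obtain n' where n': "n \<le> n'" "1 / real n' * ln (separated_sum_sup T \<phi> n' (\<epsilon> / 2)) < s"
          using freq by blast
        have "pressure_M_n T Z t \<phi> N \<epsilon> \<le> ennreal (exp (- (t - \<eta> - s) * real n'))"
          by (rule small) (use n' that in auto)
        also have "\<dots> \<le> ennreal (exp (- (t - \<eta> - s) * real n))"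
          using n'(1) t by (intro ennreal_leI) (auto intro!: mult_left_mono)
        finally show ?thesis .
      qed
      then have "eventually (\<lambda>n. pressure_M_n T Z t \<phi> N \<epsilon> \<le> ennreal (exp (- (t - \<eta> - s) * real n))) sequentially"
        by (intro eventually_sequentiallyI[of "Suc N"]) auto
      moreover have "(\<lambda>n. ennreal (exp (- (t - \<eta> - s) * real n))) \<longlonglongrightarrow> ennreal 0"
      proof (intro tendsto_ennrealI)
        have "filterlim (\<lambda>n. (t - \<eta> - s) * real n) at_top sequentially"
          using t by (intro filterlim_tendsto_pos_mult_at_top[OF tendsto_const]
              filterlim_real_sequentially) auto
        then show "(\<lambda>n. exp (- (t - \<eta> - s) * real n)) \<longlonglongrightarrow> 0"
          by (intro filterlim_compose[OF exp_at_bot]) (simp add: filterlim_uminus_at_top algebra_simps)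
      qed
      ultimately have "pressure_M_n T Z t \<phi> N \<epsilon> \<le> ennreal 0"
        by (intro tendsto_lowerbound) auto
      then show ?thesis
        by simp
    qed
    then show ?thesis
      by (simp add: pressure_M_eq_SUP)
  qed
  then have le: "pressure_at_scale T Z \<phi> \<epsilon> \<le> ereal t" if "s + \<eta> < t" for t
    unfolding pressure_at_scale_def using that by (intro Inf_lower) auto
  show ?thesis
  proof (rule ereal_le_epsilon2)
    show "pressure_at_scale T Z \<phi> \<epsilon> \<le> ereal (s + \<eta>) + ereal e" if "0 < e" for e
      using le[of "s + \<eta> + e"] that by simp
  qed
qed

text \<open>Sequences over \<open>E\<close> are realised by points of \<open>Z\<close>, so a cover
  of \<open>Z\<close> by Bowen balls induces a cover of the sequence space by cylinders. The
  assumption \<open>long\<close> says that in each block the rate \<open>h\<close> pays for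
  \<open>t\<close>, for the shadowing error and for the two gaps. The weight of the empty word is
  then a positive lower bound for the cost of every cover.\<close>

lemma pressure_M_pos:
  assumes "0 < \<epsilon>" "0 < n" "0 \<le> B" and L: "L = n + 2 * g"
    and modulus: "\<And>x y. dist x y \<le> \<epsilon> \<Longrightarrow> \<bar>\<phi> x - \<phi> y\<bar> \<le> \<eta>"
    and B: "\<And>x. \<bar>\<phi> x\<bar> \<le> B"
    and E: "finite E" "dyn_separated T n (4 * \<epsilon>) E"
    and heavy: "exp (real n * h) \<le> (\<Sum>x\<in>E. exp (birkhoff_sum T n \<phi> x))"
    and long: "t * real L + real n * \<eta> + real (2 * g) * B \<le> real n * h"
    and shadow: "\<And>\<sigma>. \<exists>x\<in>Z. \<forall>j. \<forall>i<n. dist ((T ^^ (i + j * L)) x) ((T ^^ i) (\<sigma> j)) \<le> \<epsilon>"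
  shows "pressure_M T Z t \<phi> \<epsilon> \<noteq> 0"
proof -
  have "0 < L"
    using L \<open>0 < n\<close> by simp
  obtain X where X: "\<And>\<sigma>. X \<sigma> \<in> Z"
    "\<And>\<sigma> i j. i < n \<Longrightarrow> dist ((T ^^ (i + j * L)) (X \<sigma>)) ((T ^^ i) (\<sigma> j)) \<le> \<epsilon>"
    using shadow by metis
  \<comment> \<open>By \<open>heavy\<close>, the numbers \<open>exp (gain a)\<close> with
    \<open>a\<close> in \<open>E\<close> sum to at least 1, which is what the tree argument
    requires.\<close>
  define gain where "gain x = birkhoff_sum T n \<phi> x - real n * h" for x
  \<comment> \<open>The constant factor absorbs the incomplete last block of a ball whose length is
    not a multiple of \<open>L\<close>.\<close>
  define W where "W v = ennreal (exp (- (\<bar>t\<bar> + B) * real L + (\<Sum>x\<leftarrow>v. gain x)))" for v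
  have W_step: "W v \<le> (\<Sum>a\<in>E. W (v @ [a]))" for v
  proof -
    have "1 \<le> (\<Sum>a\<in>E. exp (gain a))"
      using heavy by (simp add: gain_def exp_diff sum_divide_distrib[symmetric])
    then have "W v \<le> ennreal (exp (- (\<bar>t\<bar> + B) * real L + (\<Sum>x\<leftarrow>v. gain x)) * (\<Sum>a\<in>E. exp (gain a)))"
      unfolding W_def by (intro ennreal_leI) (metis exp_ge_zero mult.right_neutral mult_left_mono)
    also have "\<dots> = (\<Sum>a\<in>E. W (v @ [a]))"
      by (simp add: W_def sum_ennreal sum_distrib_left exp_add[symmetric] add.assoc)
    finally show ?thesis .
  qed
  \<comment> \<open>In each block, the \<open>n\<close> steps along the word lose at most
    \<open>n * \<eta>\<close>, and the remaining \<open>2 * g\<close> steps contribute at least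
    \<open>- (2 * g * B)\<close>.\<close>
  have birkhoff_ge: "(\<Sum>j<k. birkhoff_sum T n \<phi> (\<sigma> j) - real n * \<eta> - real (2 * g) * B)
      \<le> birkhoff_sum T (k * L) \<phi> (X \<sigma>)" for k \<sigma>
  proof (induction k)
    case 0
    then show ?case
      by (simp add: birkhoff_sum_def)
  next
    case (Suc k)
    define y where "y = (T ^^ (k * L)) (X \<sigma>)"
    have "birkhoff_sum T (Suc k * L) \<phi> (X \<sigma>) = birkhoff_sum T (k * L) \<phi> (X \<sigma>) + birkhoff_sum T L \<phi> y"
      using birkhoff_sum_add[of T "k * L" L \<phi> "X \<sigma>"] by (simp add: y_def add.commute)
    moreover have "birkhoff_sum T L \<phi> y = birkhoff_sum T n \<phi> y + birkhoff_sum T (2 * g) \<phi> ((T ^^ n) y)"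
      unfolding L by (rule birkhoff_sum_add)
    moreover have "- (real (2 * g) * B) \<le> birkhoff_sum T (2 * g) \<phi> ((T ^^ n) y)"
      using abs_birkhoff_sum_le[of \<phi> B T "2 * g" "(T ^^ n) y", OF B] by linarith
    moreover have "birkhoff_sum T n \<phi> (\<sigma> k) - birkhoff_sum T n \<phi> y \<le> real n * \<eta>"
    proof (rule birkhoff_sum_diff_le)
      fix i assume "i < n"
      then show "\<phi> ((T ^^ i) (\<sigma> k)) - \<phi> ((T ^^ i) y) \<le> \<eta>"
        using modulus[OF X(2)[of i k \<sigma>]] by (simp add: y_def funpow_add abs_le_iff)
    qed
    ultimately show ?case
      using Suc by simp
  qed
  have W_le: "W (map \<sigma> [0..<m div L])
      \<le> ennreal (exp (- t * real m + (SUP y \<in> bowen_ball T m x \<epsilon>. birkhoff_sum T m \<phi> y)))"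
    if mem: "X \<sigma> \<in> bowen_ball T m x \<epsilon>" for \<sigma> m x
  proof -
    define k where "k = m div L"
    have m: "m = k * L + m mod L" "m mod L < L"
      using \<open>0 < L\<close> by (auto simp: k_def)
    have "- (real L * B) \<le> birkhoff_sum T (m mod L) \<phi> ((T ^^ (k * L)) (X \<sigma>))"
    proof -
      have "real (m mod L) * B \<le> real L * B"
        using m(2) \<open>0 \<le> B\<close> by (intro mult_right_mono) auto
      then show ?thesis
        using abs_birkhoff_sum_le[of \<phi> B T "m mod L" "(T ^^ (k * L)) (X \<sigma>)", OF B] by linarith
    qed
    then have "birkhoff_sum T (k * L) \<phi> (X \<sigma>) - real L * B \<le> birkhoff_sum T m \<phi> (X \<sigma>)"
      using birkhoff_sum_add[of T "k * L" "m mod L" \<phi> "X \<sigma>"] m(1) by simp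
    also have "\<dots> \<le> (SUP y \<in> bowen_ball T m x \<epsilon>. birkhoff_sum T m \<phi> y)"
      by (rule cSUP_upper[OF mem bdd_above_birkhoff_sum])
    finally have sup: "birkhoff_sum T (k * L) \<phi> (X \<sigma>) - real L * B \<le> \<dots>" .
    \<comment> \<open>The sign of \<open>t\<close> is arbitrary, hence the absolute value.\<close>
    have "t * real (m mod L) \<le> \<bar>t\<bar> * real L"
      using m(2) by (intro mult_mono) auto
    moreover have "t * real m = t * real (k * L) + t * real (m mod L)"
      by (subst m(1)) (simp add: algebra_simps)
    ultimately have tm: "t * real m \<le> real k * (t * real L) + \<bar>t\<bar> * real L"
      by (simp add: algebra_simps)
    have "(\<Sum>j<k. gain (\<sigma> j)) + real k * (t * real L)
        = (\<Sum>j<k. gain (\<sigma> j) + t * real L)"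
      by (simp add: sum.distrib)
    also have "\<dots> \<le> (\<Sum>j<k. birkhoff_sum T n \<phi> (\<sigma> j) - real n * \<eta> - real (2 * g) * B)"
      using long by (intro sum_mono) (simp add: gain_def)
    finally have "(\<Sum>j<k. gain (\<sigma> j)) + real k * (t * real L) \<le> birkhoff_sum T (k * L) \<phi> (X \<sigma>)"
      using birkhoff_ge[where k = k and \<sigma> = \<sigma>] by linarith
    then have "- (\<bar>t\<bar> + B) * real L + (\<Sum>j<k. gain (\<sigma> j))
        \<le> - t * real m + (SUP y \<in> bowen_ball T m x \<epsilon>. birkhoff_sum T m \<phi> y)"
      using tm sup by (simp add: algebra_simps)
    moreover have "(\<Sum>x\<leftarrow>map \<sigma> [0..<m div L]. gain x) = (\<Sum>j<k. gain (\<sigma> j))"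
      by (simp add: k_def o_def interv_sum_list_conv_sum_set_nat atLeast0LessThan)
    ultimately show ?thesis
      by (simp add: W_def)
  qed
  \<comment> \<open>Distinct letters are more than \<open>4 * \<epsilon>\<close> apart at some time
    of their block. Two shadowing errors and two distances to the centre \<open>x\<close> add up to
    less than that.\<close>
  have determined: "map \<sigma> [0..<m div L] = map \<tau> [0..<m div L]"
    if "0 < m" and E': "\<And>j. \<sigma> j \<in> E" "\<And>j. \<tau> j \<in> E"
      and mem: "X \<sigma> \<in> bowen_ball T m x \<epsilon>" "X \<tau> \<in> bowen_ball T m x \<epsilon>" for \<sigma> \<tau> m x
  proof -
    have "\<sigma> j = \<tau> j" if j: "j < m div L" for j
    proof (rule ccontr)
      assume "\<sigma> j \<noteq> \<tau> j"
      then obtain i where i: "i < n" "4 * \<epsilon> < dist ((T ^^ i) (\<sigma> j)) ((T ^^ i) (\<tau> j))"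
        using E(2) E' \<open>0 < n\<close> unfolding dyn_separated_def by (metis less_dyn_dist_iff)
      have "i + j * L < Suc j * L"
        using i(1) L by simp
      also have "\<dots> \<le> m div L * L"
        using j by (intro mult_le_mono1) simp
      also have "\<dots> \<le> m"
        by simp
      finally have "i + j * L < m" .
      then have "dist ((T ^^ (i + j * L)) x) ((T ^^ (i + j * L)) (X \<sigma>)) < \<epsilon>"
        "dist ((T ^^ (i + j * L)) x) ((T ^^ (i + j * L)) (X \<tau>)) < \<epsilon>"
        using mem \<open>0 < m\<close> by (simp_all add: mem_bowen_ball_iff)
      moreover have "dist ((T ^^ (i + j * L)) (X \<sigma>)) ((T ^^ i) (\<sigma> j)) \<le> \<epsilon>"
        "dist ((T ^^ (i + j * L)) (X \<tau>)) ((T ^^ i) (\<tau> j)) \<le> \<epsilon>"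
        using X(2) i(1) by auto
      ultimately show False
        using i(2) by metric
    qed
    then show ?thesis
      by simp
  qed
  \<comment> \<open>Order 1 already suffices, as \<open>pressure_M\<close> is a supremum over
    orders, and it excludes balls of length 0.\<close>
  have "W [] \<le> pressure_M_n T Z t \<phi> 1 \<epsilon>"
    unfolding pressure_M_n_def
  proof (rule INF_greatest)
    fix C assume "C \<in> bowen_covers T Z 1 \<epsilon>"
    then have C: "\<And>x m. (x, m) \<in> C \<Longrightarrow> 0 < m" "Z \<subseteq> (\<Union>(x, m)\<in>C. bowen_ball T m x \<epsilon>)"
      by (auto simp: bowen_covers_def)
    \<comment> \<open>Balls containing no \<open>X \<sigma>\<close> with \<open>\<sigma>\<close>
      over \<open>E\<close> are discarded. Each other ball receives the word of some sequence it
      meets; by \<open>determined\<close> the choice does not matter. Balls shorter than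
      \<open>L\<close> receive the empty word.\<close>
    define meets where "meets c \<sigma> \<longleftrightarrow> (\<forall>j. \<sigma> j \<in> E) \<and> X \<sigma> \<in> bowen_ball T (snd c) (fst c) \<epsilon>" for c \<sigma>
    define C' where "C' = {c\<in>C. \<exists>\<sigma>. meets c \<sigma>}"
    define code where "code c = (SOME \<sigma>. meets c \<sigma>)" for c
    define w where "w c = map (code c) [0..<snd c div L]" for c
    define cost where "cost = (\<lambda>(x, m). ennreal (exp (- t * real m
        + (SUP y \<in> bowen_ball T m x \<epsilon>. birkhoff_sum T m \<phi> y))))"
    have code: "meets c (code c)" if "meets c \<sigma>" for c \<sigma>
      unfolding code_def using that by (rule someI[of "meets c"])
    have "W [] \<le> infsum cost C'"
    proof (rule cylinder_cover_weight[OF E(1), where w = w])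
      show "W (w c) \<le> cost c" if c: "c \<in> C'" for c
      proof -
        obtain \<sigma> where "meets c \<sigma>"
          using c by (auto simp: C'_def)
        then show ?thesis
          using W_le code unfolding w_def cost_def meets_def split_beta by blast
      qed
      show "\<exists>c\<in>C'. w c = map \<sigma> [0..<length (w c)]" if "\<And>j. \<sigma> j \<in> E" for \<sigma>
      proof -
        obtain c where c: "c \<in> C" "X \<sigma> \<in> bowen_ball T (snd c) (fst c) \<epsilon>"
          using X(1)[of \<sigma>] C(2) by fastforce
        then have "meets c \<sigma>"
          using that by (simp add: meets_def)
        moreover have "0 < snd c"
          using C(1)[of "fst c" "snd c"] c(1) by simp
        ultimately have "w c = map \<sigma> [0..<snd c div L]"
          unfolding w_def using code[of c \<sigma>] by (intro determined) (auto simp: meets_def)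
        moreover have "length (w c) = snd c div L"
          by (simp add: w_def)
        ultimately show ?thesis
          using \<open>meets c \<sigma>\<close> c(1) by (intro bexI[of _ c]) (auto simp: C'_def)
      qed
    qed (rule W_step)
    also have "\<dots> \<le> infsum cost C"
      by (rule infsum_mono_neutral) (auto simp: C'_def intro: ennreal_summable_on)
    finally show "W [] \<le> (\<Sum>\<^sub>\<infinity>(x, m)\<in>C. ennreal (exp (- t * real m
        + (SUP y \<in> bowen_ball T m x \<epsilon>. birkhoff_sum T m \<phi> y))))"
      unfolding cost_def .
  qed
  also have "\<dots> \<le> pressure_M T Z t \<phi> \<epsilon>"
    unfolding pressure_M_eq_SUP by (rule SUP_upper) simp
  finally show ?thesis
    by (auto simp: W_def)
qed

text \<open>For \<open>t < h - \<eta>\<close> each step of a word leaves a surplus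
  \<open>h - \<eta> - t\<close>, which for large \<open>n\<close> outweighs the fixed cost of the
  gaps. Hence no such \<open>t\<close> belongs to the set whose infimum is the pressure.\<close>

lemma le_pressure_at_scale:
  assumes spec: "specification_property T" and z0: "closure (forward_orbit T z0) \<noteq> UNIV"
    and "0 < \<epsilon>" and modulus: "\<And>x y. dist x y \<le> \<epsilon> \<Longrightarrow> \<bar>\<phi> x - \<phi> y\<bar> \<le> \<eta>"
    and h: "ereal h < growth (4 * \<epsilon>)"
  shows "ereal (h - \<eta>) \<le> pressure_at_scale T (non_dense_orbit_set T z0) \<phi> \<epsilon>"
proof -
  obtain B where B: "\<And>x. \<bar>\<phi> x\<bar> \<le> B"
    using potential_bounded by blast
  then have "0 \<le> B"
    using abs_ge_zero order_trans by blast
  obtain g where g: "\<And>n \<sigma>. 0 < n \<Longrightarrow> \<exists>x\<in>non_dense_orbit_set T z0.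
    \<forall>j. \<forall>i<n. dist ((T ^^ (i + j * (n + 2 * g))) x) ((T ^^ i) (\<sigma> j)) \<le> \<epsilon>"
    using shadowing_avoiding[OF compact_UNIV continuous_T spec z0 \<open>0 < \<epsilon>\<close>] by blast
  have "pressure_M T (non_dense_orbit_set T z0) t \<phi> \<epsilon> \<noteq> 0" if t: "t < h - \<eta>" for t
  proof -
    have "eventually (\<lambda>n. h < 1 / real n * ln (separated_sum_sup T \<phi> n (4 * \<epsilon>))) sequentially"
      using less_LiminfD[OF h[unfolded growth_def]] by simp
    \<comment> \<open>This threshold is the condition \<open>long\<close> of
      \<open>pressure_M_pos\<close> solved for \<open>n\<close>.\<close>
    moreover have "eventually (\<lambda>n. 2 * real g * (B + t) / (h - \<eta> - t) \<le> real n) sequentially"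
      using filterlim_real_sequentially by (simp add: filterlim_at_top)
    ultimately have "eventually (\<lambda>n. 0 < n \<and> h < 1 / real n * ln (separated_sum_sup T \<phi> n (4 * \<epsilon>))
        \<and> 2 * real g * (B + t) / (h - \<eta> - t) \<le> real n) sequentially"
      using eventually_gt_at_top[of 0] by eventually_elim simp
    then obtain n where n: "0 < n" "h < 1 / real n * ln (separated_sum_sup T \<phi> n (4 * \<epsilon>))"
        "2 * real g * (B + t) / (h - \<eta> - t) \<le> real n"
      using eventually_happens'[OF sequentially_bot] by blast
    have "real n * h < ln (separated_sum_sup T \<phi> n (4 * \<epsilon>))"
      using n(1,2) by (simp add: field_simps)
    then have "exp (real n * h) < separated_sum_sup T \<phi> n (4 * \<epsilon>)"
      using separated_sum_sup_pos[of n "4 * \<epsilon>"] n(1) \<open>0 < \<epsilon>\<close> by (metis exp_less_cancel_iff exp_ln mult_pos_pos zero_less_numeral)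
    then have "\<exists>s\<in>(\<lambda>E. \<Sum>x\<in>E. exp (birkhoff_sum T n \<phi> x)) ` {E. dyn_separated T n (4 * \<epsilon>) E}.
        exp (real n * h) < s"
      unfolding separated_sum_sup_def by (rule less_cSupD[rotated]) (auto simp: dyn_separated_def)
    then obtain E where E: "dyn_separated T n (4 * \<epsilon>) E"
      "exp (real n * h) < (\<Sum>x\<in>E. exp (birkhoff_sum T n \<phi> x))"
      by auto
    have "finite E"
      using E dyn_separated_card_bound[of n "4 * \<epsilon>"] n(1) \<open>0 < \<epsilon>\<close>
      by (metis mult_pos_pos zero_less_numeral)
    have "2 * real g * (B + t) \<le> real n * (h - \<eta> - t)"
      using n(3) t by (simp add: pos_divide_le_eq)
    then have "t * real (n + 2 * g) + real n * \<eta> + real (2 * g) * B \<le> real n * h"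
      by (simp add: algebra_simps)
    then show ?thesis
      using pressure_M_pos[OF \<open>0 < \<epsilon>\<close> n(1) \<open>0 \<le> B\<close> refl modulus B \<open>finite E\<close> E(1) less_imp_le[OF E(2)] _ g[OF n(1)]]
      by blast
  qed
  then show ?thesis
    unfolding pressure_at_scale_def by (intro Inf_greatest) (auto simp: not_less[symmetric])
qed

section \<open>Passage to the limit of small scales\<close>

lemma pressure_on_non_dense_orbit_set:
  assumes spec: "specification_property T" and z0: "closure (forward_orbit T z0) \<noteq> UNIV"
  shows "pressure_on T (non_dense_orbit_set T z0) \<phi> = top_pressure T \<phi>"
  unfolding pressure_on_def
proof (rule tendsto_Lim, simp, rule order_tendstoI)
  fix a assume "a < top_pressure T \<phi>"
  then obtain e where e: "0 < e" "a < growth e"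
    by (auto simp: top_pressure_eq less_SUP_iff)
  obtain h where h: "a < ereal h" "ereal h < growth e"
    using ereal_dense2[OF e(2)] by blast
  \<comment> \<open>The margin \<open>h - h'\<close> is spent on the oscillation of the potential,
    leaving the bound \<open>h' > a\<close>.\<close>
  obtain h' where h': "a < ereal h'" "h' < h"
    using ereal_dense2[OF h(1)] by auto
  obtain \<delta> where \<delta>: "0 < \<delta>" "\<And>x y. dist x y < \<delta> \<Longrightarrow> \<bar>\<phi> x - \<phi> y\<bar> \<le> h - h'"
    using potential_modulus[of "h - h'"] h'(2) by auto
  \<comment> \<open>The bound \<open>e / 4\<close> ensures \<open>4 * \<epsilon> < e\<close>, so
    that \<open>growth (4 * \<epsilon>)\<close> still exceeds \<open>h\<close>.\<close>
  have "eventually (\<lambda>\<epsilon>. \<epsilon> \<in> {0<..<min (e / 4) \<delta>}) (at_right 0)"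
    using e(1) \<delta>(1) by (intro eventually_at_right_real) simp
  then show "eventually (\<lambda>\<epsilon>. a < pressure_at_scale T (non_dense_orbit_set T z0) \<phi> \<epsilon>) (at_right 0)"
  proof eventually_elim
    case (elim \<epsilon>)
    have "ereal h < growth (4 * \<epsilon>)"
      using h(2) growth_antimono[of "4 * \<epsilon>" e] elim by (auto intro: less_le_trans)
    then have "ereal (h - (h - h')) \<le> pressure_at_scale T (non_dense_orbit_set T z0) \<phi> \<epsilon>"
      using elim \<delta>(2) by (intro le_pressure_at_scale[OF spec z0]) auto
    with h'(1) show ?case
      by (auto intro: less_le_trans)
  qed
next
  fix b assume "top_pressure T \<phi> < b"
  then obtain d where d: "top_pressure T \<phi> < ereal d" "ereal d < b"
    using ereal_dense2 by blast
  \<comment> \<open>Likewise \<open>d - c\<close> is the oscillation allowed, so that the upper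
    estimate ends at \<open>d < b\<close>.\<close>
  obtain c where c: "top_pressure T \<phi> < ereal c" "c < d"
    using ereal_dense2[OF d(1)] by auto
  obtain \<delta> where \<delta>: "0 < \<delta>" "\<And>x y. dist x y < \<delta> \<Longrightarrow> \<bar>\<phi> x - \<phi> y\<bar> \<le> d - c"
    using potential_modulus[of "d - c"] c(2) by auto
  have "eventually (\<lambda>\<epsilon>. \<epsilon> \<in> {0<..<\<delta>}) (at_right 0)"
    using \<delta>(1) by (rule eventually_at_right_real)
  then show "eventually (\<lambda>\<epsilon>. pressure_at_scale T (non_dense_orbit_set T z0) \<phi> \<epsilon> < b) (at_right 0)"
  proof eventually_elim
    case (elim \<epsilon>)
    have "growth (\<epsilon> / 2) \<le> top_pressure T \<phi>"
      unfolding top_pressure_eq using elim by (intro SUP_upper) auto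
    then have "growth (\<epsilon> / 2) < ereal c"
      using c(1) by (rule le_less_trans)
    then have "pressure_at_scale T (non_dense_orbit_set T z0) \<phi> \<epsilon> \<le> ereal (c + (d - c))"
      using elim \<delta>(2) by (intro pressure_at_scale_le) auto
    with d(2) show ?case
      by (auto intro: le_less_trans)
  qed
qed

end

theorem theorem1p1:
  fixes T :: "'a::metric_space \<Rightarrow> 'a"
    and z0 :: 'a
    and \<phi> :: "'a \<Rightarrow> real"
  assumes "compact (UNIV :: 'a set)"
    and "continuous_on UNIV T"
    and "specification_property T"
    and "closure (forward_orbit T z0) \<noteq> UNIV"
    and "continuous_on UNIV \<phi>"
  shows "non_dense_orbit_set T z0 = {} \<or>
         pressure_on T (non_dense_orbit_set T z0) \<phi> = top_pressure T \<phi>"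
  using compact_system.pressure_on_non_dense_orbit_set[of T \<phi> z0] assms
  by (simp add: compact_system_def)

end
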